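(* Let $\kappa\in\mathbb{Z}\setminus\{4\}$ and let $p>3$ be a prime. If $(\kappa-4)(4\kappa-7)\not\equiv0\pmod p$ and $\left(\frac{4\kappa-7}{p}\right)=1$, then $\mathcal{G}_\kappa(p)$ contains a subdivision of $K_{3,3}$.
   Context: $\kappa$ is regarded in $\mathbb{F}_p$; $\left(\frac{\cdot}{p}\right)$ is the Legendre symbol. $\mathcal{M}_\kappa(p)=\{(x,y,z)\in\mathbb{F}_p^3 : x^2+y^2+z^2=xyz+\kappa\}$; Vieta involutions $R_1(x,y,z)=(yz-x,y,z)$, $R_2(x,y,z)=(x,zx-y,z)$, $R_3(x,y,z)=(x,y,xy-z)$. $\mathcal{G}_\kappa(p)$ is the $3$-regular graph (possibly with loops) on vertex set $\mathcal{M}_\kappa(p)$ with an edge joining $X$ and $R_i(X)$ for each vertex $X$ and each $i\in\{1,2,3\}$. *)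

theory Defs
  imports "HOL-Number_Theory.Number_Theory" "Graph_Theory.Graph_Theory"
begin

text \<open>
  The field with \<open>p\<close> elements is the library's \<open>residue_ring (int p)\<close>, whose carrier consists of
  the canonical representatives \<open>0, \<dots>, p - 1\<close>; equality of representatives is equality in the field.
\<close>

type_synonym point = "int \<times> int \<times> int"

definition markoff_surface :: "int \<Rightarrow> nat \<Rightarrow> point set" where
  "markoff_surface \<kappa> p =
     {(x, y, z). x \<in> carrier (residue_ring (int p)) \<and> y \<in> carrier (residue_ring (int p))
        \<and> z \<in> carrier (residue_ring (int p))
        \<and> [x^2 + y^2 + z^2 = x * y * z + \<kappa>] (mod int p)}"

text \<open>Only the indices 1, 2 and 3 are used.\<close>

definition vieta :: "nat \<Rightarrow> nat \<Rightarrow> point \<Rightarrow> point" where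
  "vieta p i = (\<lambda>(x, y, z).
     if i = 1 then ((y * z - x) mod int p, y, z)
     else if i = 2 then (x, (z * x - y) mod int p, z)
     else (x, y, (x * y - z) mod int p))"

text \<open>
  Undirected graphs are represented as symmetric digraphs. The arc \<open>(X, Y, i)\<close>, for
  \<open>Y = vieta p i X\<close>, runs from \<open>X\<close> to \<open>Y\<close>; the arcs \<open>(X, Y, i)\<close> and \<open>(Y, X, i)\<close> are the two
  orientations of one edge, and they coincide for a loop. The label \<open>i\<close> keeps loops of
  different indices at one vertex apart, which makes the graph 3-regular. Both end points are
  stored in the arc because \<open>subdivision\<close> relates graphs that have the same functions
  \<open>tail\<close> and \<open>head\<close>: every pair of points has to be the ends of some arc of the type for
  the graph that is subdivided to be available.
\<close>

definition markoff_graph :: "int \<Rightarrow> nat \<Rightarrow> (point, point \<times> point \<times> nat) pre_digraph" where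
  "markoff_graph \<kappa> p =
     \<lparr> verts = markoff_surface \<kappa> p,
       arcs = {(X, vieta p i X, i) | X i. X \<in> markoff_surface \<kappa> p \<and> i \<in> {1, 2, 3}},
       tail = fst,
       head = fst \<circ> snd \<rparr>"

text \<open>The first disjunct of the Kuratowski condition in \<open>kuratowski_planar\<close>.\<close>

definition contains_K33_subdivision :: "('a, 'b) pre_digraph \<Rightarrow> bool" where
  "contains_K33_subdivision G \<longleftrightarrow>
     (\<exists>H. subgraph H G
        \<and> (\<exists>K rev_K rev_H. subdivision (K, rev_K) (H, rev_H) \<and> K\<^bsub>3,3\<^esub> K))"

lemma vieta_involutive:
  assumes "X \<in> markoff_surface \<kappa> p"
  shows "vieta p i (vieta p i X) = X"
  using assms
  by (auto simp: vieta_def markoff_surface_def residue_ring_def mod_diff_right_eq split: prod.splits)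

lemma markoff_equation_vieta:
  fixes x y z \<kappa> m :: int
  assumes "[x^2 + y^2 + z^2 = x * y * z + \<kappa>] (mod m)"
  shows "[((y * z - x) mod m)^2 + y^2 + z^2 = ((y * z - x) mod m) * y * z + \<kappa>] (mod m)"
proof -
  define x' where "x' = (y * z - x) mod m"
  obtain k where k: "x' = y * z - x - m * k"
    unfolding x'_def by (metis minus_mult_div_eq_mod)
  obtain l where l: "x^2 + y^2 + z^2 - (x * y * z + \<kappa>) = m * l"
    using assms by (auto simp: cong_iff_dvd_diff)
  have "x'^2 + y^2 + z^2 - (x' * y * z + \<kappa>) = m * (l - k * (y * z - 2 * x - m * k))"
    unfolding k right_diff_distrib[of m l] l[symmetric] by (simp add: algebra_simps power2_eq_square)
  then show ?thesis
    unfolding x'_def[symmetric] by (simp add: cong_iff_dvd_diff)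
qed

lemma vieta_in_markoff_surface:
  assumes "p > 0" "X \<in> markoff_surface \<kappa> p"
  shows "vieta p i X \<in> markoff_surface \<kappa> p"
proof -
  obtain x y z where X: "X = (x, y, z)" by (cases X)
  have c: "t mod int p \<in> carrier (residue_ring (int p))" for t
    using assms(1) by (simp add: residue_ring_def)
  have e: "[x^2 + y^2 + z^2 = x * y * z + \<kappa>] (mod int p)"
    using assms(2) by (simp add: markoff_surface_def X)
  show ?thesis
    using assms(2) c
      markoff_equation_vieta[of x y z \<kappa> "int p"]
      markoff_equation_vieta[of y z x \<kappa> "int p"]
      markoff_equation_vieta[of z x y \<kappa> "int p"]
    by (auto simp: X vieta_def markoff_surface_def ac_simps)
qed

lemma finite_markoff_surface: "finite (markoff_surface \<kappa> p)"
proof (rule finite_subset)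
  show "markoff_surface \<kappa> p \<subseteq> {0..int p - 1} \<times> {0..int p - 1} \<times> {0..int p - 1}"
    by (auto simp: markoff_surface_def residue_ring_def)
qed auto

lemma pseudo_graph_markoff_graph:
  assumes "p > 0"
  shows "pseudo_graph (markoff_graph \<kappa> p)"
proof
  have "arcs (markoff_graph \<kappa> p) =
      (\<lambda>(X, i). (X, vieta p i X, i)) ` (markoff_surface \<kappa> p \<times> {1, 2, 3})"
    by (auto simp: markoff_graph_def image_iff)
  then show "finite (arcs (markoff_graph \<kappa> p))"
    by (simp add: finite_markoff_surface)
  show "symmetric (markoff_graph \<kappa> p)"
    unfolding symmetric_conv
  proof
    fix e assume "e \<in> arcs (markoff_graph \<kappa> p)"
    then obtain X i where e: "e = (X, vieta p i X, i)" "X \<in> markoff_surface \<kappa> p" "i \<in> {1, 2, 3}"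
      by (auto simp: markoff_graph_def)
    have "(vieta p i X, X, i) \<in> arcs (markoff_graph \<kappa> p)"
      using e vieta_in_markoff_surface[OF assms e(2), of i] vieta_involutive[OF e(2), of i]
      unfolding markoff_graph_def by simp (metis prod_cases3)
    then show "\<exists>e'\<in>arcs (markoff_graph \<kappa> p). tail (markoff_graph \<kappa> p) e = head (markoff_graph \<kappa> p) e'
        \<and> head (markoff_graph \<kappa> p) e = tail (markoff_graph \<kappa> p) e'"
      by (rule bexI[rotated]) (simp add: e markoff_graph_def)
  qed
qed (auto simp: markoff_graph_def finite_markoff_surface intro: vieta_in_markoff_surface[OF assms])

lemma out_degree_markoff_graph:
  assumes "X \<in> markoff_surface \<kappa> p"
  shows "out_degree (markoff_graph \<kappa> p) X = 3"
proof -
  have "out_arcs (markoff_graph \<kappa> p) X = (\<lambda>i. (X, vieta p i X, i)) ` {1, 2, 3}"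
    using assms by (auto simp: out_arcs_def markoff_graph_def)
  then show ?thesis
    by (simp add: out_degree_def card_insert_if)
qed

end

theory Submission
  imports Defs
begin

text \<open>
  The hypothesis on \<open>4 * \<kappa> - 7\<close> makes the discriminant of \<open>t\<^sup>2 - t + (2 - \<kappa>)\<close> a nonzero square, so
  there are \<open>a \<noteq> b\<close> in the field with \<open>a + b = 1\<close> and \<open>a * b = 2 - \<kappa>\<close>; neither equals \<open>-1\<close>,
  because \<open>\<kappa> \<noteq> 4\<close>. All triples with entries in \<open>{-1, a, b}\<close> in which \<open>a\<close> and \<open>b\<close> occur at most once
  each, and at least one of them occurs, lie on the surface. The three triples whose only entry
  other than \<open>-1\<close> is \<open>a\<close>, and the three where it is \<open>b\<close>, are the two sides of the \<open>K\<^sub>3\<^sub>,\<^sub>3\<close>: with the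
  special entries at positions \<open>i\<close> and \<open>j\<close>, respectively, they are adjacent if \<open>i = j\<close>, and otherwise
  joined through the triple that has \<open>a\<close> at position \<open>i\<close> and \<open>b\<close> at position \<open>j\<close>.
\<close>

section \<open>Symmetric graphs given by labelled edges, and subdividing their edges\<close>

definition flip :: "'v \<times> 'v \<times> 'l \<Rightarrow> 'v \<times> 'v \<times> 'l" where
  "flip = (\<lambda>(u, v, l). (v, u, l))"

lemma flip_simps [simp]: "flip (u, v, l) = (v, u, l)" "flip (flip e) = e"
  by (auto simp: flip_def split: prod.splits)

definition sym_arcs :: "('v \<times> 'v \<times> 'l) set \<Rightarrow> ('v \<times> 'v \<times> 'l) set" where
  "sym_arcs E = E \<union> flip ` E"

lemma sym_arcs_iff: "(u, v, l) \<in> sym_arcs E \<longleftrightarrow> (u, v, l) \<in> E \<or> (v, u, l) \<in> E"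
proof -
  have "e \<in> flip ` E \<longleftrightarrow> flip e \<in> E" for e
    by (metis flip_simps(2) image_iff)
  then show ?thesis
    by (simp add: sym_arcs_def)
qed

lemma sym_arcs_insert: "sym_arcs (insert (u, v, l) E) = {(u, v, l), (v, u, l)} \<union> sym_arcs E"
  by (auto simp: sym_arcs_def)

definition labelled_graph :: "'v set \<Rightarrow> ('v \<times> 'v \<times> 'l) set \<Rightarrow> ('v, 'v \<times> 'v \<times> 'l) pre_digraph" where
  "labelled_graph V E = \<lparr>verts = V, arcs = sym_arcs E, tail = fst, head = fst \<circ> snd\<rparr>"

text \<open>The identity outside the arcs is forced: the reversal of a
  \<open>bidirected_digraph\<close> moves exactly the arcs.\<close>

definition rev_arc :: "('v \<times> 'v \<times> 'l) set \<Rightarrow> 'v \<times> 'v \<times> 'l \<Rightarrow> 'v \<times> 'v \<times> 'l" where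
  "rev_arc E e = (if e \<in> sym_arcs E then flip e else e)"

text \<open>Loops are excluded because \<open>flip\<close> fixes them, whereas a reversal has to
  move every arc; parallel edges remain possible.\<close>

definition simple_edges :: "'v set \<Rightarrow> ('v \<times> 'v \<times> 'l) set \<Rightarrow> bool" where
  "simple_edges V E \<longleftrightarrow> (\<forall>(u, v, l) \<in> E. u \<in> V \<and> v \<in> V \<and> u \<noteq> v)"

lemma bidirected_labelled_graph:
  fixes E :: "('v \<times> 'v \<times> 'l) set"
  assumes "simple_edges V E"
  shows "bidirected_digraph (labelled_graph V E) (rev_arc E)"
proof -
  have ends: "u \<in> V \<and> v \<in> V \<and> u \<noteq> v" if "(u, v, l) \<in> sym_arcs E" for u v l
    using that assms by (auto simp: simple_edges_def sym_arcs_iff)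
  have rev: "rev_arc E (u, v, l) = (if (u, v, l) \<in> sym_arcs E then (v, u, l) else (u, v, l))"
    for u v l
    by (simp add: rev_arc_def)
  have sym: "(v, u, l) \<in> sym_arcs E \<longleftrightarrow> (u, v, l) \<in> sym_arcs E" for u v l
    by (auto simp: sym_arcs_iff)
  show ?thesis
  proof
    fix e :: "'v \<times> 'v \<times> 'l"
    obtain u v l where e: "e = (u, v, l)" by (cases e)
    show "e \<in> arcs (labelled_graph V E) \<longleftrightarrow> rev_arc E e \<noteq> e"
      using ends[of u v l] by (simp add: labelled_graph_def rev e)
    assume "e \<in> arcs (labelled_graph V E)"
    then have "(u, v, l) \<in> sym_arcs E" by (simp add: labelled_graph_def e)
    with ends[of u v l] sym[of u v l]
    show "tail (labelled_graph V E) e \<in> verts (labelled_graph V E)"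
      "head (labelled_graph V E) e \<in> verts (labelled_graph V E)"
      "rev_arc E (rev_arc E e) = e"
      "tail (labelled_graph V E) (rev_arc E e) = head (labelled_graph V E) e"
      by (simp_all add: labelled_graph_def rev e)
  qed
qed

text \<open>The two halves have labels of their own, since in the Markoff graph they come from
  different involutions. If \<open>E\<close> held either orientation of the replaced edge,
  \<open>sym_arcs\<close> would bring that edge back.\<close>

lemma subdivision_step_labelled_graph:
  assumes "simple_edges V (insert (u, v, l) E)" "w \<notin> V"
    and "(u, v, l) \<notin> E" "(v, u, l) \<notin> E"
  shows "subdivision_step
    (labelled_graph V (insert (u, v, l) E)) (rev_arc (insert (u, v, l) E))
    (labelled_graph (insert w V) (insert (u, w, l1) (insert (v, w, l2) E)))
    (rev_arc (insert (u, w, l1) (insert (v, w, l2) E)))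
    (u, v, w) ((u, v, l), (u, w, l1), (v, w, l2))"
    (is "subdivision_step (labelled_graph V ?E) _ (labelled_graph _ ?F) _ _ _")
proof -
  have ends: "u \<noteq> v" "u \<noteq> w" "v \<noteq> w" and "u \<in> V" "v \<in> V"
    using assms(1,2) by (auto simp: simple_edges_def)
  have "simple_edges (insert w V) ?F"
    using assms(1) ends \<open>u \<in> V\<close> \<open>v \<in> V\<close> by (auto simp: simple_edges_def)
  then have "bidirected_digraph (labelled_graph V ?E) (rev_arc ?E)"
    and "bidirected_digraph (labelled_graph (insert w V) ?F) (rev_arc ?F)"
    using assms by (auto intro: bidirected_labelled_graph)
  \<comment> \<open>On the common arcs both reversals are \<open>flip\<close>; the restrictions fix
    everything else.\<close>
  moreover have "perm_restrict (rev_arc ?F) (sym_arcs ?E) = perm_restrict (rev_arc ?E) (sym_arcs ?F)"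
    by (auto simp: perm_restrict_def rev_arc_def fun_eq_iff)
  moreover have "sym_arcs ?F =
      {(u, w, l1), (w, u, l1), (v, w, l2), (w, v, l2)} \<union> sym_arcs ?E - {(u, v, l), (v, u, l)}"
  proof -
    have "(u, v, l) \<notin> sym_arcs E" "(v, u, l) \<notin> sym_arcs E"
      using assms(3,4) by (simp_all add: sym_arcs_iff)
    then show ?thesis
      using ends by (auto simp: sym_arcs_insert)
  qed
  ultimately show ?thesis
    using ends \<open>w \<notin> V\<close>
    by (simp add: subdivision_step_def labelled_graph_def rev_arc_def compatible_def
        arc_to_ends_def sym_arcs_insert)
qed

text \<open>Start from an abstract K33 on the points \<alpha> i and \<beta> j and subdivide the
  edges of the pairs in \<open>D\<close> one at a time, with \<mu> i j as the new vertex. Only the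
  final graph has to lie in \<open>G\<close>, so no arc of \<open>G\<close> between \<alpha> i and
  \<beta> j is required for pairs in \<open>D\<close>.\<close>

lemma contains_K33_subdivisionI:
  fixes G :: "('v, 'v \<times> 'v \<times> 'l) pre_digraph" and \<alpha> :: "'i \<Rightarrow> 'v" and \<beta> :: "'j \<Rightarrow> 'v"
  assumes G: "wf_digraph G" "tail G = fst" "head G = fst \<circ> snd"
    and sym: "\<And>u v k. (u, v, k) \<in> arcs G \<Longrightarrow> (v, u, k) \<in> arcs G"
    and card: "card I = 3" "card J = 3"
    and inj: "inj_on \<alpha> I" "inj_on \<beta> J" and disj: "\<alpha> ` I \<inter> \<beta> ` J = {}"
    and D: "D \<subseteq> I \<times> J" "inj_on (case_prod \<mu>) D"
    and \<mu>: "case_prod \<mu> ` D \<inter> (\<alpha> ` I \<union> \<beta> ` J) = {}"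
    and direct: "\<And>i j. (i, j) \<in> I \<times> J - D \<Longrightarrow> (\<alpha> i, \<beta> j, l i j) \<in> arcs G"
    and left: "\<And>i j. (i, j) \<in> D \<Longrightarrow> (\<alpha> i, \<mu> i j, la i j) \<in> arcs G"
    and right: "\<And>i j. (i, j) \<in> D \<Longrightarrow> (\<beta> j, \<mu> i j, lb i j) \<in> arcs G"
  shows "contains_K33_subdivision G"
proof -
  interpret G: wf_digraph G by fact
  define V where "V S = \<alpha> ` I \<union> \<beta> ` J \<union> case_prod \<mu> ` S" for S
  define E where "E R S = (\<lambda>(i, j). (\<alpha> i, \<beta> j, l i j)) ` R \<union>
    ((\<lambda>(i, j). (\<alpha> i, \<mu> i j, la i j)) ` S \<union> (\<lambda>(i, j). (\<beta> j, \<mu> i j, lb i j)) ` S)" for R S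
  \<comment> \<open>The stage at which precisely the pairs in \<open>S\<close> are subdivided: K33
    for \<open>{}\<close>, the subgraph of \<open>G\<close> for \<open>D\<close>.\<close>
  define graph_of where "graph_of S = labelled_graph (V S) (E (I \<times> J - S) S)" for S
  define rev_of where "rev_of S = rev_arc (E (I \<times> J - S) S)" for S
  have fin: "finite I" "finite J" using card by (auto intro: card_ge_0_finite)
  have \<alpha>\<beta>: "\<alpha> i \<noteq> \<beta> j" if "i \<in> I" "j \<in> J" for i j
    using disj that by blast
  have \<mu>\<alpha>: "\<mu> i j \<noteq> \<alpha> k" if "(i, j) \<in> D" "k \<in> I" for i j k
    using \<mu> that by fastforce
  have \<mu>\<beta>: "\<mu> i j \<noteq> \<beta> k" if "(i, j) \<in> D" "k \<in> J" for i j k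
    using \<mu> that by fastforce
  have simple: "simple_edges (V S) (E (I \<times> J - S) S)" if "S \<subseteq> D" for S
  proof -
    have "i \<in> I \<and> j \<in> J \<and> (i, j) \<in> D" if "(i, j) \<in> S" for i j
      using that \<open>S \<subseteq> D\<close> D(1) by auto
    then show ?thesis
      by (auto simp: simple_edges_def V_def E_def \<alpha>\<beta> \<mu>\<alpha>[symmetric] \<mu>\<beta>[symmetric])
  qed
  have "subdivision (graph_of {}, rev_of {}) (graph_of S, rev_of S)" if "finite S" "S \<subseteq> D" for S
    using that
  proof (induction S rule: finite_induct)
    case empty
    show ?case
      unfolding graph_of_def rev_of_def
      by (intro subdivision_base bidirected_labelled_graph simple) simp
  next
    case (insert x S)
    obtain i j where x: "x = (i, j)" by (cases x)
    have S: "S \<subseteq> D" and ij: "(i, j) \<in> D" "(i, j) \<notin> S" "i \<in> I" "j \<in> J"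
      using insert D(1) by (auto simp: x)
    have S': "i' \<in> I \<and> j' \<in> J \<and> (i', j') \<in> D" if "(i', j') \<in> S" for i' j'
      using that S D(1) by auto
    let ?R = "I \<times> J - insert (i, j) S"
    \<comment> \<open>Both stages are written over the common remainder \<open>E ?R S\<close>, as
      the single subdivision step expects.\<close>
    have before: "E (I \<times> J - S) S = insert (\<alpha> i, \<beta> j, l i j) (E ?R S)"
    proof -
      have "I \<times> J - S = insert (i, j) ?R" using ij by auto
      then show ?thesis by (simp add: E_def)
    qed
    have after: "E ?R (insert x S) =
        insert (\<alpha> i, \<mu> i j, la i j) (insert (\<beta> j, \<mu> i j, lb i j) (E ?R S))"
      by (auto simp: E_def x)
    have "\<mu> i j \<noteq> \<mu> i' j'" if "(i', j') \<in> S" for i' j'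
      using inj_onD[OF D(2), of "(i, j)" "(i', j')"] that ij S' by auto
    then have "\<mu> i j \<notin> V S"
      using ij \<mu>\<alpha> \<mu>\<beta> by (auto simp: V_def)
    \<comment> \<open>By injectivity a direct arc with these ends belongs to the pair
      \<open>(i, j)\<close>, which \<open>?R\<close> omits; the half edges end at some \<mu>
      instead.\<close>
    moreover have "(\<alpha> i, \<beta> j, l i j) \<notin> E ?R S"
      using S' ij inj by (auto simp: E_def \<alpha>\<beta> \<mu>\<beta>[symmetric] inj_on_eq_iff)
    moreover have "(\<beta> j, \<alpha> i, l i j) \<notin> E ?R S"
      using S' ij by (auto simp: E_def \<alpha>\<beta>[symmetric] \<mu>\<alpha>[symmetric])
    moreover have "V (insert x S) = insert (\<mu> i j) (V S)"
      by (auto simp: V_def x)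
    ultimately have "subdivision_step (graph_of S) (rev_of S) (graph_of (insert x S))
        (rev_of (insert x S)) (\<alpha> i, \<beta> j, \<mu> i j)
        ((\<alpha> i, \<beta> j, l i j), (\<alpha> i, \<mu> i j, la i j), (\<beta> j, \<mu> i j, lb i j))"
      using subdivision_step_labelled_graph[of "V S" "\<alpha> i" "\<beta> j" "l i j" "E ?R S" "\<mu> i j"]
        simple[OF S] after
      by (simp add: graph_of_def rev_of_def before x)
    with insert.IH[OF S] show ?case
      by (rule subdivision.divide[where biI = "(_, _)" and biH = "(_, _)", unfolded fst_conv snd_conv])
  qed
  from this[OF _ order_refl] have "subdivision (graph_of {}, rev_of {}) (graph_of D, rev_of D)"
    using D(1) fin by (auto intro: finite_subset)
  moreover have "subgraph (graph_of D) G"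
  proof (rule subgraphI)
    show "wf_digraph (graph_of D)"
      unfolding graph_of_def
      by (rule bidirected_digraph.axioms(1)[OF bidirected_labelled_graph[OF simple[OF order_refl]]])
    have "E (I \<times> J - D) D \<subseteq> arcs G"
      using direct left right by (auto simp: E_def)
    moreover have "flip e \<in> arcs G" if "e \<in> arcs G" for e
      using that sym by (cases e) simp
    ultimately show "arcs (graph_of D) \<subseteq> arcs G"
      by (auto simp: graph_of_def labelled_graph_def sym_arcs_def)
    have ends: "u \<in> verts G \<and> v \<in> verts G" if "(u, v, k) \<in> arcs G" for u v k
      using G.wellformed[OF that] by (simp add: G)
    \<comment> \<open>A branch vertex paired with any index of the other side is the end of a direct
      arc or of a half edge, hence a vertex of \<open>G\<close>.\<close>
    have "I \<noteq> {}" "J \<noteq> {}" using card by auto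
    then have "\<alpha> i \<in> verts G" if "i \<in> I" for i
      using that direct left ends by (metis DiffI SigmaI all_not_in_conv)
    moreover have "\<beta> j \<in> verts G" if "j \<in> J" for j
      using that direct right ends \<open>I \<noteq> {}\<close> by (metis DiffI SigmaI all_not_in_conv)
    moreover have "\<mu> i j \<in> verts G" if "(i, j) \<in> D" for i j
      using left[OF that] ends by blast
    ultimately show "verts (graph_of D) \<subseteq> verts G"
      by (auto simp: graph_of_def labelled_graph_def V_def)
  qed (auto simp: graph_of_def labelled_graph_def compatible_def G)
  moreover have "K\<^bsub>3,3\<^esub> (graph_of {})"
  proof -
    have "bidirected_digraph (graph_of {}) (rev_of {})"
      unfolding graph_of_def rev_of_def by (intro bidirected_labelled_graph simple) simp
    then interpret K: bidirected_digraph "graph_of {}" "rev_of {}" .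
    have K_simps: "verts (graph_of {}) = \<alpha> ` I \<union> \<beta> ` J" "tail (graph_of {}) = fst"
      "head (graph_of {}) = fst \<circ> snd" "arcs (graph_of {}) = sym_arcs (E (I \<times> J) {})"
      by (auto simp: graph_of_def labelled_graph_def V_def)
    have K_arc: "(u, v, k) \<in> sym_arcs (E (I \<times> J) {}) \<longleftrightarrow>
        (\<exists>i\<in>I. \<exists>j\<in>J. k = l i j \<and> (u = \<alpha> i \<and> v = \<beta> j \<or> u = \<beta> j \<and> v = \<alpha> i))" for u v k
      by (auto simp: sym_arcs_iff E_def)
    have "graph (graph_of {})"
    proof
      show "finite (verts (graph_of {}))" "finite (arcs (graph_of {}))"
        using fin by (auto simp: K_simps sym_arcs_def E_def)
      show "tail (graph_of {}) e \<noteq> head (graph_of {}) e" if "e \<in> arcs (graph_of {})" for e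
        using that \<alpha>\<beta> by (cases e) (auto simp: K_simps K_arc \<alpha>\<beta>[symmetric])
      \<comment> \<open>The ends of an arc determine \<open>i\<close> and \<open>j\<close>, and
        these determine the label, so no two arcs are parallel.\<close>
      show "e = f" if "e \<in> arcs (graph_of {})" "f \<in> arcs (graph_of {})"
        and "arc_to_ends (graph_of {}) e = arc_to_ends (graph_of {}) f" for e f
        using that inj
        by (cases e; cases f)
          (auto simp: K_simps K_arc arc_to_ends_def \<alpha>\<beta> \<alpha>\<beta>[symmetric] inj_on_eq_iff)
    qed
    moreover have "arcs_ends (graph_of {}) = \<alpha> ` I \<times> \<beta> ` J \<union> \<beta> ` J \<times> \<alpha> ` I"
    proof -
      have "(u, v) \<in> arcs_ends (graph_of {}) \<longleftrightarrow> (\<exists>k. (u, v, k) \<in> sym_arcs (E (I \<times> J) {}))" for u v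
        by (force simp: arcs_ends_conv K_simps)
      then show ?thesis
        by (auto simp: K_arc) blast+
    qed
    moreover have "card (\<alpha> ` I) = 3" "card (\<beta> ` J) = 3"
      using card inj by (simp_all add: card_image)
    ultimately show ?thesis
      unfolding complete_bipartite_digraph_def using disj
      by (intro conjI exI[of _ "\<alpha> ` I"] exI[of _ "\<beta> ` J"])
        (auto simp: K_simps)
  qed
  ultimately show ?thesis
    unfolding contains_K33_subdivision_def by blast
qed

section \<open>Points and arcs of the Markoff graph, coordinate by coordinate\<close>

definition mod_point :: "nat \<Rightarrow> (nat \<Rightarrow> int) \<Rightarrow> point" where
  "mod_point p f = (f 1 mod int p, f 2 mod int p, f 3 mod int p)"

lemma mod_point_eq_iff:
  "mod_point p f = mod_point p g \<longleftrightarrow> (\<forall>i \<in> {1, 2, 3}. [f i = g i] (mod int p))"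
  by (auto simp: mod_point_def cong_def)

lemma mod_point_in_markoff_surface:
  assumes "p > 0"
    and "[(f 1)\<^sup>2 + (f 2)\<^sup>2 + (f 3)\<^sup>2 = f 1 * f 2 * f 3 + \<kappa>] (mod int p)"
  shows "mod_point p f \<in> markoff_surface \<kappa> p"
proof -
  have "[(f 1 mod int p)\<^sup>2 + (f 2 mod int p)\<^sup>2 + (f 3 mod int p)\<^sup>2 = (f 1)\<^sup>2 + (f 2)\<^sup>2 + (f 3)\<^sup>2] (mod int p)"
    by (intro cong_add cong_pow) auto
  moreover have "[f 1 * f 2 * f 3 + \<kappa> = (f 1 mod int p) * (f 2 mod int p) * (f 3 mod int p) + \<kappa>] (mod int p)"
    by (intro cong_add cong_mult) auto
  ultimately show ?thesis
    using assms by (auto simp: mod_point_def markoff_surface_def residue_ring_def intro: cong_trans)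
qed

text \<open>With the other two coordinates fixed, the surface equation is a monic quadratic in
  coordinate \<open>i\<close> whose roots sum to the product of those two; the involution swaps the
  roots. Treating points as functions of the position covers all three involutions at once.\<close>

lemma arc_markoff_graph:
  assumes "mod_point p f \<in> markoff_surface \<kappa> p" "i \<in> {1, 2, 3}"
    and "[f i + w = prod f ({1, 2, 3} - {i})] (mod int p)"
  shows "(mod_point p f, mod_point p (f(i := w)), i) \<in> arcs (markoff_graph \<kappa> p)"
proof -
  have prods: "prod f ({1, 2, 3} - {1}) = f 2 * f 3" "prod f ({1, 2, 3} - {2}) = f 3 * f 1"
    "prod f ({1, 2, 3} - {3}) = f 1 * f 2"
    by (simp_all add: insert_Diff_if mult.commute)
  have w: "w mod int p = (prod f ({1, 2, 3} - {i}) - f i) mod int p"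
    using assms(3) by (metis cong_def add_diff_cancel_left' mod_diff_left_eq)
  have prod_diff: "(x mod int p * (y mod int p) - z) mod int p = (x * y - z) mod int p" for x y z
    by (metis mod_mult_eq mod_diff_left_eq)
  consider "i = 1" | "i = 2" | "i = 3" using assms(2) by blast
  then have "vieta p i (mod_point p f) = mod_point p (f(i := w))"
    by cases (use w in \<open>simp_all only: prods, simp_all add: vieta_def mod_point_def prod_diff mod_diff_right_eq\<close>)
  with assms(1,2) show ?thesis
    unfolding markoff_graph_def by (simp del: split_paired_Ex)
qed

text \<open>Completing the square reduces the first property to
  \<open>(2 * a - 1)\<^sup>2 = 4 * \<kappa> - 7\<close> modulo \<open>p\<close>. The other three
  make \<open>-1\<close>, \<open>a\<close> and \<open>1 - a\<close> pairwise distinct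
  residues.\<close>

lemma obtain_roots:
  fixes \<kappa> :: int and p :: nat
  assumes "prime p" "p > 3"
    and "\<not> [(\<kappa> - 4) * (4 * \<kappa> - 7) = 0] (mod int p)"
    and "Legendre (4 * \<kappa> - 7) (int p) = 1"
  obtains a :: int where "[a * (1 - a) = 2 - \<kappa>] (mod int p)" "\<not> [a = 1 - a] (mod int p)"
    "\<not> [a = - 1] (mod int p)" "\<not> [1 - a = - 1] (mod int p)"
proof -
  have odd: "odd p" using \<open>prime p\<close> \<open>p > 3\<close> by (simp add: prime_odd_nat)
  have \<kappa>: "\<not> [4 * \<kappa> - 7 = 0] (mod int p)" "\<not> [\<kappa> - 4 = 0] (mod int p)"
    using assms(3) by (auto simp: cong_0_iff)
  obtain s where s: "[s\<^sup>2 = 4 * \<kappa> - 7] (mod int p)"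
    using assms(4) by (auto simp: Legendre_def QuadRes_def split: if_splits)
  \<comment> \<open>As \<open>p\<close> is odd, one of \<open>s\<close> and \<open>s + p\<close> is
    odd, and an odd number has the form \<open>2 * a - 1\<close>.\<close>
  obtain a where a: "[(2 * a - 1)\<^sup>2 = 4 * \<kappa> - 7] (mod int p)"
  proof (cases "odd s")
    case True
    then obtain c where "s = 2 * c + 1" by (rule oddE)
    then have "2 * (c + 1) - 1 = s" by simp
    with s that[of "c + 1"] show ?thesis by simp
  next
    case False
    then have "odd (s + int p)" using odd by simp
    then obtain c where "s + int p = 2 * c + 1" by (rule oddE)
    then have "2 * (c + 1) - 1 = s + int p" by simp
    moreover have "[(s + int p)\<^sup>2 = s\<^sup>2] (mod int p)"
      by (intro cong_pow) (simp add: cong_def)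
    ultimately show ?thesis using s that[of "c + 1"] cong_trans by metis
  qed
  define b where "b = 1 - a"
  have ab: "[a * b = 2 - \<kappa>] (mod int p)"
  proof -
    have "coprime 4 (int p)"
      using odd by (metis coprime_left_2_iff_odd coprime_power_left_iff even_of_nat num_double numeral_times_numeral power2_eq_square)
    moreover have "int p dvd 4 * (a * b - (2 - \<kappa>))"
    proof -
      have "4 * (a * b - (2 - \<kappa>)) = - ((2 * a - 1)\<^sup>2 - (4 * \<kappa> - 7))"
        by (simp add: b_def power2_eq_square algebra_simps)
      then show ?thesis using a by (simp only: dvd_minus_iff cong_iff_dvd_diff)
    qed
    ultimately show ?thesis
      unfolding cong_iff_dvd_diff using coprime_dvd_mult_right_iff coprime_commute by blast
  qed
  have "\<not> [a = b] (mod int p)"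
  proof
    assume "[a = b] (mod int p)"
    then have "int p dvd 2 * a - 1" by (simp add: b_def cong_iff_dvd_diff algebra_simps)
    then have "[(2 * a - 1)\<^sup>2 = 0] (mod int p)" by (simp add: cong_0_iff power2_eq_square)
    then show False using a \<kappa>(1) by (meson cong_sym cong_trans)
  qed
  \<comment> \<open>At \<open>c = -1\<close> the product \<open>c * (1 - c)\<close> is
    \<open>-2\<close>; equating it with \<open>2 - \<kappa>\<close> would give \<kappa> = 4 modulo
    \<open>p\<close>.\<close>
  moreover have not_m1: "\<not> [c = - 1] (mod int p)" if "c = a \<or> c = b" for c
  proof
    assume "[c = - 1] (mod int p)"
    then have "[c * (1 - c) = - 1 * (1 - - 1)] (mod int p)" by (intro cong_mult cong_diff) auto
    moreover have "c * (1 - c) = a * b" using that by (auto simp: b_def)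
    ultimately have "[- 2 = 2 - \<kappa>] (mod int p)" using ab by (auto intro: cong_trans cong_sym)
    then show False using \<kappa>(2) by (simp add: cong_iff_dvd_diff)
  qed
  ultimately show thesis
    using that[of a] ab unfolding b_def by blast
qed

theorem theorem4p1:
  fixes \<kappa> :: int and p :: nat
  assumes "\<kappa> \<noteq> 4"
    and "prime p" and "p > 3"
    and "\<not> [(\<kappa> - 4) * (4 * \<kappa> - 7) = 0] (mod int p)"
    and "Legendre (4 * \<kappa> - 7) (int p) = 1"
  shows "contains_K33_subdivision (markoff_graph \<kappa> p)"
proof -
  obtain a where a: "[a * (1 - a) = 2 - \<kappa>] (mod int p)" "\<not> [a = 1 - a] (mod int p)"
    "\<not> [a = - 1] (mod int p)" "\<not> [1 - a = - 1] (mod int p)"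
    using obtain_roots assms by metis
  define b where "b = 1 - a"
  have ab: "[a * b = 2 - \<kappa>] (mod int p)" using a(1) by (simp add: b_def)
  have distinct: "\<not> [a = b] (mod int p)" "\<not> [b = a] (mod int p)"
    "\<not> [a = - 1] (mod int p)" "\<not> [b = - 1] (mod int p)"
    "\<not> [- 1 = a] (mod int p)" "\<not> [- 1 = b] (mod int p)"
    using a by (simp_all add: b_def cong_sym_eq)
  define \<alpha> where "\<alpha> i = mod_point p ((\<lambda>_. - 1)(i := a))" for i
  define \<beta> where "\<beta> j = mod_point p ((\<lambda>_. - 1)(j := b))" for j
  define \<mu> where "\<mu> i j = mod_point p ((\<lambda>_. - 1)(i := a, j := b))" for i j
  let ?I = "{1, 2, 3 :: nat}"
  let ?D = "?I \<times> ?I - Id"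
  note wf = pseudo_graph.axioms(1)[OF pseudo_graph_markoff_graph, THEN fin_digraph.axioms(1)]
  show ?thesis
  \<comment> \<open>The label is the coordinate that changes along the arc. For
    \<open>i \<noteq> j\<close> the value \<open>l i j = i\<close> is an arbitrary choice, as that
    edge is subdivided.\<close>
  proof (rule contains_K33_subdivisionI[where I = ?I and J = ?I and D = ?D and \<alpha> = \<alpha> and \<beta> = \<beta>
        and \<mu> = \<mu> and l = "\<lambda>i j. i" and la = "\<lambda>i j. j" and lb = "\<lambda>i j. i"])
    show "wf_digraph (markoff_graph \<kappa> p)" using wf \<open>p > 3\<close> by simp
    show "(Y, X, k) \<in> arcs (markoff_graph \<kappa> p)" if "(X, Y, k) \<in> arcs (markoff_graph \<kappa> p)" for X Y k
      using that \<open>p > 3\<close> vieta_in_markoff_surface[of p X \<kappa> k] vieta_involutive[of X \<kappa> p k]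
      by (auto simp: markoff_graph_def simp del: split_paired_Ex)
    \<comment> \<open>Since \<open>-1\<close>, \<open>a\<close>, \<open>b\<close> are distinct
      residues, a triple determines the positions of its entries \<open>a\<close> and
      \<open>b\<close>.\<close>
    show "inj_on \<alpha> ?I" "inj_on \<beta> ?I" "\<alpha> ` ?I \<inter> \<beta> ` ?I = {}" "inj_on (case_prod \<mu>) ?D"
      "case_prod \<mu> ` ?D \<inter> (\<alpha> ` ?I \<union> \<beta> ` ?I) = {}"
      using distinct by (auto simp: \<alpha>_def \<beta>_def \<mu>_def mod_point_eq_iff inj_on_def)
    \<comment> \<open>With entries \<open>-1\<close>, \<open>-1\<close>, \<open>t\<close> the
      equation reads \<open>2 + t^2 = t + \<kappa>\<close>, that is,
      \<open>t * (1 - t) = 2 - \<kappa>\<close>.\<close>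
    have surface: "\<alpha> i \<in> markoff_surface \<kappa> p" "\<beta> i \<in> markoff_surface \<kappa> p" if "i \<in> ?I" for i
      unfolding \<alpha>_def \<beta>_def by (rule mod_point_in_markoff_surface; use that \<open>p > 3\<close> ab in 
       \<open>auto simp: b_def cong_iff_dvd_diff power2_eq_square algebra_simps\<close>)+
    \<comment> \<open>Here \<open>i = j\<close>, and \<open>a\<close> is exchanged for
      \<open>b\<close> because \<open>a + b = 1 = (-1) * (-1)\<close>.\<close>
    show "(\<alpha> i, \<beta> j, i) \<in> arcs (markoff_graph \<kappa> p)" if "(i, j) \<in> ?I \<times> ?I - ?D" for i j
      using that arc_markoff_graph[of p "(\<lambda>_. - 1)(i := a)" \<kappa> i b] surface[of i]
      by (auto simp: \<alpha>_def \<beta>_def b_def insert_Diff_if)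
    \<comment> \<open>The \<open>-1\<close> at position \<open>j\<close> becomes \<open>b\<close>:
      \<open>-1 + b = -a\<close> is the product of the other entries \<open>a\<close> and
      \<open>-1\<close>.\<close>
    show "(\<alpha> i, \<mu> i j, j) \<in> arcs (markoff_graph \<kappa> p)" if "(i, j) \<in> ?D" for i j
      using that arc_markoff_graph[of p "(\<lambda>_. - 1)(i := a)" \<kappa> j b] surface[of i]
      by (auto simp: \<alpha>_def \<mu>_def b_def insert_Diff_if)
    \<comment> \<open>Symmetrically \<open>-1 + a = -b\<close>; the two updates commute as
      \<open>i \<noteq> j\<close>.\<close>
    show "(\<beta> j, \<mu> i j, i) \<in> arcs (markoff_graph \<kappa> p)" if "(i, j) \<in> ?D" for i j
      using that arc_markoff_graph[of p "(\<lambda>_. - 1)(j := b)" \<kappa> i a] surface[of j]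
      by (auto simp: \<beta>_def \<mu>_def b_def insert_Diff_if fun_upd_twist)
  qed (auto simp: markoff_graph_def)
qed

end
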